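(* Let $k\ge1$ and let $f_1,f_2,\ldots,f_k$ be transcendental entire functions of finite order, each of which has the annular domain property for some $m>1$. Suppose that there exist $n\in\mathbb N$ and $q\in(0,1)$ such that, for all $j\in\{1,2,\ldots,k\}$, $$M(r,f_j)\ge\exp^{n+1}\big((\log^n r)^q\big)\quad\text{for large } r.$$ Let $g=f_1\circ f_2\circ\cdots\circ f_k$. Then every component of the Fatou set $F(g)$ is bounded.
   Context: $\mathbb N=\{1,2,\ldots\}$; $\exp^n$ and $\log^n$ denote the $n$th iterates of $\exp$ and $\log$. For an entire function $f$ put $M(r,f)=\max_{|z|=r}|f(z)|$ for $r>0$, and $B(0,r)=\{z\in\mathbb C:|z|<r\}$. The order of a transcendental entire function $f$ is $\rho(f)=\limsup_{r\to\infty}\frac{\log\log M(r,f)}{\log r}$. The Fatou set $F(f)$ is the set of $z\in\mathbb C$ such that the iterates $(f^n)_{n\ge1}$ form a normal family in a neighbourhood of $z$. An entire function $f$ has the annular domain property for $m>1$ if there exists $R_0>0$ such that, for all $r\ge R_0$, there is a simply connected domain $G=G(r)$ with $B(0,r)\subset G\subset B(0,r^m)$ and $|f(z)|\ge M(r,f)$ for all $z\in\partial G$. *)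

theory Defs
  imports "HOL-Complex_Analysis.Complex_Analysis"
begin

definition transcendental_entire :: "(complex \<Rightarrow> complex) \<Rightarrow> bool" where
  "transcendental_entire f \<longleftrightarrow>
     f holomorphic_on UNIV \<and> \<not> (\<exists>p :: complex poly. \<forall>z. f z = poly p z)"

text \<open>The maximum modulus; the supremum is attained, see \<open>max_modulus_attained\<close>.\<close>

definition max_modulus :: "real \<Rightarrow> (complex \<Rightarrow> complex) \<Rightarrow> real" where
  "max_modulus r f = (SUP z\<in>sphere 0 r. norm (f z))"

lemma max_modulus_attained:
  assumes "continuous_on UNIV f" "r \<ge> 0"
  shows "\<exists>z\<in>sphere 0 r. norm (f z) = max_modulus r f \<and> (\<forall>w\<in>sphere 0 r. norm (f w) \<le> norm (f z))"
proof -
  have "continuous_on (sphere 0 r) (\<lambda>z. norm (f z))"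
    using assms(1) by (intro continuous_on_norm) (rule continuous_on_subset, auto)
  moreover have "sphere (0::complex) r \<noteq> {}"
    using assms(2) by simp
  ultimately obtain z where z: "z \<in> sphere 0 r" "\<forall>w\<in>sphere 0 r. norm (f w) \<le> norm (f z)"
    using continuous_attains_sup[OF compact_sphere] by blast
  have "max_modulus r f = norm (f z)"
    unfolding max_modulus_def using z by (intro cSup_eq_maximum) auto
  with z show ?thesis by auto
qed

definition entire_order :: "(complex \<Rightarrow> complex) \<Rightarrow> ereal" where
  "entire_order f = Limsup at_top (\<lambda>r. ereal (ln (ln (max_modulus r f)) / ln r))"

definition annular_domain_property :: "(complex \<Rightarrow> complex) \<Rightarrow> real \<Rightarrow> bool" where
  "annular_domain_property f m \<longleftrightarrow>
     (\<exists>R\<^sub>0>0. \<forall>r\<ge>R\<^sub>0. \<exists>G. open G \<and> connected G \<and> simply_connected G \<and>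
        ball 0 r \<subseteq> G \<and> G \<subseteq> ball 0 (r powr m) \<and>
        (\<forall>z\<in>frontier G. norm (f z) \<ge> max_modulus r f))"

text \<open>
  Normality of a family of holomorphic functions on a domain, with values in the
  Riemann sphere: every sequence in the family has a subsequence that converges,
  uniformly on compact subsets, either to a (holomorphic) function or to infinity.
\<close>

definition normal_family_on :: "(complex \<Rightarrow> complex) set \<Rightarrow> complex set \<Rightarrow> bool" where
  "normal_family_on \<F> U \<longleftrightarrow>
     (\<forall>h :: nat \<Rightarrow> complex \<Rightarrow> complex. range h \<subseteq> \<F> \<longrightarrow>
        (\<exists>\<phi> :: nat \<Rightarrow> nat. strict_mono \<phi> \<and>
           ((\<exists>l. l holomorphic_on U \<and>
               (\<forall>K. compact K \<and> K \<subseteq> U \<longrightarrow> uniform_limit K (h \<circ> \<phi>) l sequentially)) \<or>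
            (\<forall>K. compact K \<and> K \<subseteq> U \<longrightarrow>
               (\<forall>B::real. eventually (\<lambda>i. \<forall>z\<in>K. norm (h (\<phi> i) z) > B) sequentially)))))"

text \<open>
  The neighbourhood is taken connected, so that a spherical limit of holomorphic
  functions on it is either holomorphic or identically infinity.
\<close>

definition fatou_set :: "(complex \<Rightarrow> complex) \<Rightarrow> complex set" where
  "fatou_set f =
     {z. \<exists>U. open U \<and> connected U \<and> z \<in> U \<and> normal_family_on {f ^^ n |n. n \<ge> 1} U}"

end

theory Submission
  imports Defs
begin

text \<open>
  Near a Fatou point, normality and Harnack's inequality bound \<open>ln (e + \<bar>g^j x\<bar>)\<close> by a constant,
  independent of \<open>j\<close>, times \<open>ln (e + \<bar>g^j y\<bar>)\<close>; by compactness this holds on any path inside a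
  Fatou component. On the other hand an unbounded component contains a path \<open>K\<close> from a point \<open>z\<close>
  with \<open>\<bar>z\<bar> \<le> exp^n s\<close> to a point of modulus at least \<open>exp^n t\<close>, with \<open>t\<close> as large as we please
  compared to \<open>s\<close>. Finite order turns the upper bound \<open>exp^n s\<close> for the image of \<open>z\<close> into
  \<open>exp^n (exp (N s))\<close> at each application of some \<open>f\<^sub>j\<close>. The image of \<open>K\<close> crosses the boundary of
  an annular domain, which turns the lower bound \<open>exp^n t\<close> for its largest modulus into
  \<open>exp^n (exp ((t / N)^q))\<close>. If \<open>t\<close> is initially large enough, the ratio of the two parameters
  tends to infinity under this recursion, contradicting the bound on \<open>K\<close>.
\<close>

section \<open>A Harnack inequality on the Fatou set\<close>

text \<open>In the right half-plane \<open>a\<close> lies nearer to \<open>b\<close> than to the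
  mirror image \<open>- cnj b\<close>. Hence the Cayley-type quotient of the two differences lies in
  the unit disc.\<close>

lemma norm_diff_less_norm_add_cnj:
  fixes a b :: complex
  assumes "Re a > 0" "Re b > 0"
  shows "norm (a - b) < norm (a + cnj b)"
proof -
  have "(norm (a + cnj b))\<^sup>2 - (norm (a - b))\<^sup>2 = 4 * Re a * Re b"
    unfolding cmod_power2 by (simp add: power2_eq_square algebra_simps)
  moreover have "4 * Re a * Re b > 0"
    using assms by simp
  ultimately have "(norm (a - b))\<^sup>2 < (norm (a + cnj b))\<^sup>2"
    by linarith
  thus ?thesis
    by (rule power_less_imp_less_base) simp
qed

text \<open>The Schwarz lemma, applied to the Cayley transform of \<open>H\<close> centred at
  \<open>H w\<close>, bounds it by 1/2 on the half-radius ball; the constant is 3 = (1 + 1/2) / (1 -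
  1/2).\<close>

lemma Harnack_ball:
  fixes H :: "complex \<Rightarrow> complex"
  assumes hol: "H holomorphic_on ball w R" and pos: "\<And>z. z \<in> ball w R \<Longrightarrow> Re (H z) > 0"
    and x: "x \<in> ball w (R / 2)"
  shows "Re (H x) \<le> 3 * Re (H w)" "Re (H w) \<le> 3 * Re (H x)"
proof -
  have R: "R > 0"
    using x by (smt (verit) dist_not_less_zero mem_ball field_sum_of_halves)
  define F :: "complex \<Rightarrow> complex" where "F \<xi> = (H (w + of_real R * \<xi>) - H w) / (H (w + of_real R * \<xi>) + cnj (H w))" for \<xi>
  have inb: "w + R * \<xi> \<in> ball w R" if "norm \<xi> < 1" for \<xi> :: complex
    using that R by (simp add: dist_norm norm_mult)
  have w: "Re (H w) > 0"
    using pos R by simp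
  have ne: "H (w + R * \<xi>) + cnj (H w) \<noteq> 0" if "norm \<xi> < 1" for \<xi> :: complex
    using pos[OF inb[OF that]] w by (auto simp: complex_eq_iff)
  have holc: "(\<lambda>\<xi>::complex. H (w + R * \<xi>)) holomorphic_on ball 0 1"
  proof -
    have "(H \<circ> (\<lambda>\<xi>::complex. w + R * \<xi>)) holomorphic_on ball 0 1"
      by (intro holomorphic_on_compose_gen[OF _ hol] holomorphic_intros) (auto simp del: mem_ball intro!: inb)
    thus ?thesis by (simp add: o_def)
  qed
  have "F holomorphic_on ball 0 1"
    unfolding F_def using ne by (intro holomorphic_intros holc) auto
  moreover have "norm (F \<xi>) < 1" if "norm \<xi> < 1" for \<xi>
    using norm_diff_less_norm_add_cnj[OF pos[OF inb[OF that]] w] ne[OF that]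
    by (simp add: F_def norm_divide divide_simps)
  moreover have "F 0 = 0"
    by (simp add: F_def)
  moreover define \<xi> where "\<xi> = (x - w) / R"
  have \<xi>: "norm \<xi> < 1 / 2"
    using x R by (simp add: \<xi>_def norm_divide dist_norm norm_minus_commute field_simps)
  ultimately have "norm (F \<xi>) \<le> norm \<xi>"
    by (intro Schwarz_Lemma(1)) auto
  hence F: "norm (F \<xi>) \<le> 1 / 2"
    using \<xi> by linarith
  have xe: "w + R * \<xi> = x"
    using R by (simp add: \<xi>_def)
  have ne': "H x + cnj (H w) \<noteq> 0"
    using ne[of \<xi>] \<xi> xe by simp
  have "2 * norm (H x - H w) \<le> norm (H x + cnj (H w))"
    using F ne' unfolding F_def xe by (simp add: norm_divide divide_simps)
  hence "(2 * norm (H x - H w))\<^sup>2 \<le> (norm (H x + cnj (H w)))\<^sup>2"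
    by (intro power_mono) auto
  \<comment> \<open>The imaginary part of \<open>H x + cnj (H w)\<close> equals that of
    \<open>H x - H w\<close>, so its square moves to the left and leaves the coefficient 4 - 1 =
    3.\<close>
  hence "4 * (Re (H x) - Re (H w))\<^sup>2 + 3 * (Im (H x) - Im (H w))\<^sup>2 \<le> (Re (H x) + Re (H w))\<^sup>2"
    by (simp add: power_mult_distrib cmod_power2)
  moreover have "(2 * (Re (H x) - Re (H w)))\<^sup>2 = 4 * (Re (H x) - Re (H w))\<^sup>2"
    by (simp only: power_mult_distrib) simp
  ultimately have "(2 * (Re (H x) - Re (H w)))\<^sup>2 \<le> (Re (H x) + Re (H w))\<^sup>2"
    using zero_le_power2[of "Im (H x) - Im (H w)"] by linarith
  hence "\<bar>2 * (Re (H x) - Re (H w))\<bar> \<le> \<bar>Re (H x) + Re (H w)\<bar>"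
    by (simp only: abs_le_square_iff)
  moreover have "Re (H x) > 0"
    using pos[of x] x R by simp
  ultimately have "\<bar>2 * (Re (H x) - Re (H w))\<bar> \<le> Re (H x) + Re (H w)"
    using w by linarith
  thus "Re (H x) \<le> 3 * Re (H w)" "Re (H w) \<le> 3 * Re (H x)"
    by (simp_all add: abs_le_iff)
qed

text \<open>Without zeros on the ball, \<open>h\<close> has a holomorphic logarithm there, whose
  real part is positive. Comparing \<open>x\<close> and \<open>y\<close> through the centre costs 3
  * 3 = 9.\<close>

lemma Harnack_ln_norm:
  fixes h :: "complex \<Rightarrow> complex"
  assumes hol: "h holomorphic_on ball w R" and gt1: "\<And>z. z \<in> ball w R \<Longrightarrow> norm (h z) > 1"
    and x: "x \<in> ball w (R / 2)" and y: "y \<in> ball w (R / 2)"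
  shows "ln (norm (h x)) \<le> 9 * ln (norm (h y))"
proof -
  have "h z \<noteq> 0" if "z \<in> ball w R" for z
    using gt1[OF that] by auto
  then obtain H where H: "H holomorphic_on ball w R" "\<And>z. z \<in> ball w R \<Longrightarrow> h z = exp (H z)"
    using contractible_imp_holomorphic_log[OF hol convex_imp_contractible[OF convex_ball]] by metis
  have Re: "Re (H z) = ln (norm (h z))" if "z \<in> ball w R" for z
    using H(2)[OF that] by simp
  have pos: "Re (H z) > 0" if "z \<in> ball w R" for z
    using Re[OF that] ln_gt_zero[OF gt1[OF that]] by simp
  have "Re (H x) \<le> 3 * Re (H w)" "Re (H w) \<le> 3 * Re (H y)"
    using Harnack_ball[OF H(1) pos] x y by auto
  moreover have "x \<in> ball w R" "y \<in> ball w R"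
    using x y by (auto, (smt (verit) dist_not_less_zero field_sum_of_halves)+)
  ultimately show ?thesis
    using Re by simp
qed

section \<open>Harnack bounds for normal families\<close>

lemma one_le_ln_exp_add:
  fixes x :: real
  assumes "x \<ge> 0"
  shows "ln (exp 1 + x) \<ge> 1"
proof -
  have "ln (exp 1) \<le> ln (exp 1 + x)"
    using assms by (intro ln_mono) (auto intro: add_pos_nonneg)
  thus ?thesis by simp
qed

lemma ln_exp_add_le:
  fixes x :: real
  assumes "x \<ge> 3"
  shows "ln (exp 1 + x) \<le> 2 * ln x"
proof -
  have "exp 1 + x \<le> x * x"
    using exp_le assms mult_right_mono[of 3 x x] by linarith
  hence "ln (exp 1 + x) \<le> ln (x * x)"
    using assms by (intro ln_mono) (auto intro: add_pos_pos)
  thus ?thesis using assms by (simp add: ln_mult)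
qed

text \<open>Otherwise some sequence violates the bound with constant \<open>i\<close> for every
  \<open>i\<close>. A subsequence with finite limit is uniformly bounded near \<open>z\<close>, and
  the right-hand logarithm is at least 1 thanks to the summand e; a subsequence tending to infinity
  obeys \<open>Harnack_ln_norm\<close>.\<close>

lemma normal_family_Harnack:
  assumes nf: "normal_family_on \<F> U" and U: "open U" "z \<in> U"
    and hol: "\<And>h. h \<in> \<F> \<Longrightarrow> h holomorphic_on U"
  obtains \<delta> L where "\<delta> > 0" "L \<ge> 0"
    "\<And>h x y. h \<in> \<F> \<Longrightarrow> x \<in> ball z \<delta> \<Longrightarrow> y \<in> ball z \<delta> \<Longrightarrow>
       ln (exp 1 + norm (h x)) \<le> L * ln (exp 1 + norm (h y))"
proof -
  obtain R where R: "R > 0" "cball z R \<subseteq> U"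
    using U open_contains_cball by blast
  have "\<exists>i::nat. \<forall>h\<in>\<F>. \<forall>x\<in>ball z (R/2). \<forall>y\<in>ball z (R/2).
          ln (exp 1 + norm (h x)) \<le> i * ln (exp 1 + norm (h y))"
  proof (rule ccontr)
    assume "\<not> ?thesis"
    hence "\<forall>i::nat. \<exists>h x y. h \<in> \<F> \<and> x \<in> ball z (R/2) \<and> y \<in> ball z (R/2) \<and>
             ln (exp 1 + norm (h x)) > i * ln (exp 1 + norm (h y))"
      by (meson not_le_imp_less)
    then obtain h x y where hxy: "\<And>i::nat. h i \<in> \<F>" "\<And>i. x i \<in> ball z (R/2)" "\<And>i. y i \<in> ball z (R/2)"
        "\<And>i. ln (exp 1 + norm (h i (x i))) > i * ln (exp 1 + norm (h i (y i)))"
      by metis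
    have sub: "ball z (R/2) \<subseteq> cball z R" "ball z R \<subseteq> cball z R"
      using R by auto
    have "range h \<subseteq> \<F>"
      using hxy(1) by auto
    then obtain \<phi> :: "nat \<Rightarrow> nat" where \<phi>: "strict_mono \<phi>" and alt:
      "(\<exists>l. l holomorphic_on U \<and>
               (\<forall>K. compact K \<and> K \<subseteq> U \<longrightarrow> uniform_limit K (h \<circ> \<phi>) l sequentially)) \<or>
            (\<forall>K. compact K \<and> K \<subseteq> U \<longrightarrow>
               (\<forall>B::real. eventually (\<lambda>i. \<forall>z\<in>K. norm (h (\<phi> i) z) > B) sequentially))"
      using nf unfolding normal_family_on_def by blast
    have \<phi>ge: "i \<le> \<phi> i" for i
      using \<phi> by (rule strict_mono_imp_increasing)
    from alt show False
    proof
      assume "\<exists>l. l holomorphic_on U \<and>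
               (\<forall>K. compact K \<and> K \<subseteq> U \<longrightarrow> uniform_limit K (h \<circ> \<phi>) l sequentially)"
      then obtain l where l: "l holomorphic_on U" "uniform_limit (cball z R) (h \<circ> \<phi>) l sequentially"
        using R(2) compact_cball by blast
      have "compact (l ` cball z R)"
        using l(1) R(2)
        by (meson compact_cball compact_continuous_image continuous_on_subset holomorphic_on_imp_continuous_on)
      then obtain B where B: "\<And>u. u \<in> cball z R \<Longrightarrow> norm (l u) \<le> B"
        by (metis bounded_iff compact_imp_bounded image_eqI)
      have "eventually (\<lambda>i. \<forall>u\<in>cball z R. dist ((h \<circ> \<phi>) i u) (l u) < 1) sequentially"
        using l(2) by (simp add: uniform_limit_iff)
      moreover have "eventually (\<lambda>i. real i \<ge> ln (exp 1 + (B + 1))) sequentially"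
        using filterlim_real_sequentially by (auto simp: filterlim_at_top)
      ultimately have "eventually (\<lambda>i. (\<forall>u\<in>cball z R. dist ((h \<circ> \<phi>) i u) (l u) < 1)
          \<and> real i \<ge> ln (exp 1 + (B + 1))) sequentially"
        by (rule eventually_conj)
      then obtain i where "(\<forall>u\<in>cball z R. dist ((h \<circ> \<phi>) i u) (l u) < 1)
          \<and> real i \<ge> ln (exp 1 + (B + 1))"
        using eventually_happens sequentially_bot by blast
      hence i: "\<And>u. u \<in> cball z R \<Longrightarrow> dist (h (\<phi> i) u) (l u) < 1"
          "real i \<ge> ln (exp 1 + (B + 1))"
        by auto
      define j where "j = \<phi> i"
      have "x j \<in> cball z R"
        using hxy(2) sub by blast
      hence "norm (h j (x j)) \<le> B + 1"
        using i(1)[of "x j"] B[of "x j"] norm_triangle_sub[of "h j (x j)" "l (x j)"]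
        by (simp add: j_def dist_norm)
      hence "ln (exp 1 + norm (h j (x j))) \<le> ln (exp 1 + (B + 1))"
        by (intro ln_mono) (auto intro: add_pos_nonneg)
      also have "\<dots> \<le> real j"
        using i(2) \<phi>ge[of i] by (simp add: j_def)
      also have "\<dots> = real j * 1" by simp
      also have "\<dots> \<le> real j * ln (exp 1 + norm (h j (y j)))"
        by (intro mult_left_mono one_le_ln_exp_add) auto
      finally show False
        using hxy(4)[of j] by simp
    next
      assume "\<forall>K. compact K \<and> K \<subseteq> U \<longrightarrow>
               (\<forall>B::real. eventually (\<lambda>i. \<forall>z\<in>K. norm (h (\<phi> i) z) > B) sequentially)"
      hence "eventually (\<lambda>i. \<forall>u\<in>cball z R. norm (h (\<phi> i) u) > 3) sequentially"
        using R(2) compact_cball by blast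
      then obtain i0 where "\<And>i. i \<ge> i0 \<Longrightarrow> \<forall>u\<in>cball z R. norm (h (\<phi> i) u) > 3"
        by (auto simp: eventually_sequentially)
      \<comment> \<open>The shift puts the index past \<open>i0\<close> and also above 18 = 9 * 2,
        the product of the constants in \<open>Harnack_ln_norm\<close> and
        \<open>ln_exp_add_le\<close>.\<close>
      hence i: "\<forall>u\<in>cball z R. norm (h (\<phi> (i0 + 18)) u) > 3"
        by simp
      define j where "j = \<phi> (i0 + 18)"
      have j: "norm (h j u) > 3" if "u \<in> cball z R" for u
        using i that by (simp add: j_def)
      have "j \<ge> 18"
        using \<phi>ge[of "i0 + 18"] by (simp add: j_def)
      have hj: "h j holomorphic_on ball z R"
        using hol[OF hxy(1)] R(2) sub by (meson holomorphic_on_subset order_trans)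
      have "norm (h j u) > 1" if "u \<in> ball z R" for u
        using j[of u] that by auto
      hence "ln (norm (h j (x j))) \<le> 9 * ln (norm (h j (y j)))"
        by (intro Harnack_ln_norm[OF hj _ hxy(2,3)])
      moreover have "norm (h j (x j)) > 3" "norm (h j (y j)) > 3"
        using hxy(2,3) sub j by blast+
      moreover from this have "ln (norm (h j (y j))) \<le> ln (exp 1 + norm (h j (y j)))"
        by (intro ln_mono) auto
      moreover have "ln (exp 1 + norm (h j (x j))) \<le> 2 * ln (norm (h j (x j)))"
        using calculation by (intro ln_exp_add_le) auto
      ultimately have "ln (exp 1 + norm (h j (x j))) \<le> 18 * ln (exp 1 + norm (h j (y j)))"
        by linarith
      also have "\<dots> \<le> real j * ln (exp 1 + norm (h j (y j)))"
        using \<open>j \<ge> 18\<close> one_le_ln_exp_add[of "norm (h j (y j))"] by (intro mult_right_mono) auto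
      finally show False
        using hxy(4)[of j] by simp
    qed
  qed
  then obtain i :: nat where "\<forall>h\<in>\<F>. \<forall>x\<in>ball z (R/2). \<forall>y\<in>ball z (R/2).
          ln (exp 1 + norm (h x)) \<le> i * ln (exp 1 + norm (h y))"
    by blast
  thus ?thesis
    using R by (intro that[of "R/2" "real i"]) auto
qed

section \<open>Harnack bounds for all iterates on compact connected sets\<close>

lemma holomorphic_on_UNIV_compose:
  assumes "f holomorphic_on UNIV" "g holomorphic_on UNIV"
  shows "(f \<circ> g) holomorphic_on UNIV"
  by (meson assms holomorphic_on_compose holomorphic_on_subset subset_UNIV)

lemma holomorphic_on_UNIV_funpow:
  assumes "f holomorphic_on UNIV"
  shows "(f ^^ j) holomorphic_on UNIV"
proof (induction j)
  case 0
  then show ?case by (simp add: id_def)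
next
  case (Suc j)
  then show ?case
    by (simp only: funpow.simps) (rule holomorphic_on_UNIV_compose[OF assms])
qed

lemma fatou_local_Harnack:
  assumes "g holomorphic_on UNIV" "z \<in> fatou_set g"
  obtains \<delta> L where "\<delta> > 0" "L \<ge> 0"
    "\<And>j x y. j \<ge> 1 \<Longrightarrow> x \<in> ball z \<delta> \<Longrightarrow> y \<in> ball z \<delta> \<Longrightarrow>
       ln (exp 1 + norm ((g ^^ j) x)) \<le> L * ln (exp 1 + norm ((g ^^ j) y))"
proof -
  obtain U where U: "open U" "z \<in> U" "normal_family_on {g ^^ n |n. n \<ge> 1} U"
    using assms(2) unfolding fatou_set_def by blast
  have "h holomorphic_on U" if "h \<in> {g ^^ n |n. n \<ge> 1}" for h
    using that holomorphic_on_UNIV_funpow[OF assms(1)] holomorphic_on_subset by blast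
  from normal_family_Harnack[OF U(3,1,2) this] obtain \<delta> L where dL: "\<delta> > 0" "L \<ge> 0"
    "\<And>h x y. h \<in> {g ^^ n |n. n \<ge> 1} \<Longrightarrow> x \<in> ball z \<delta> \<Longrightarrow> y \<in> ball z \<delta> \<Longrightarrow>
       ln (exp 1 + norm (h x)) \<le> L * ln (exp 1 + norm (h y))"
    by blast
  show ?thesis
  proof (rule that[OF dL(1,2)])
    fix j x y
    assume "(1::nat) \<le> j" "x \<in> ball z \<delta>" "y \<in> ball z \<delta>"
    thus "ln (exp 1 + norm ((g ^^ j) x)) \<le> L * ln (exp 1 + norm ((g ^^ j) y))"
      by (intro dL(3)) auto
  qed
qed

lemma open_fatou_set: "open (fatou_set g)"
proof -
  have "fatou_set g = \<Union>{U. open U \<and> connected U \<and> normal_family_on {g ^^ n |n. n \<ge> 1} U}"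
    unfolding fatou_set_def by blast
  thus ?thesis by auto
qed

text \<open>Connectedness chains the local bounds from \<open>z\<close> to every point of
  \<open>K\<close>; compactness then makes the constant independent of the point.\<close>

lemma fatou_compact_Harnack:
  assumes g: "g holomorphic_on UNIV" and K: "connected K" "compact K" "K \<subseteq> fatou_set g" "z \<in> K"
  obtains L where "L \<ge> 0" "\<And>j w. j \<ge> 1 \<Longrightarrow> w \<in> K \<Longrightarrow>
       ln (exp 1 + norm ((g ^^ j) w)) \<le> L * ln (exp 1 + norm ((g ^^ j) z))"
proof -
  define \<Phi> where "\<Phi> j w = ln (exp 1 + norm ((g ^^ j) w))" for j w
  have \<Phi>0: "\<Phi> j w \<ge> 0" for j w
    using one_le_ln_exp_add[of "norm ((g ^^ j) w)"] by (simp add: \<Phi>_def)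
  define D where "D w \<delta> L \<longleftrightarrow> \<delta> > 0 \<and> L \<ge> 0 \<and>
    (\<forall>j\<ge>1. \<forall>x\<in>ball w \<delta>. \<forall>y\<in>ball w \<delta>. \<Phi> j x \<le> L * \<Phi> j y)" for w \<delta> L
  have loc: "\<exists>\<delta> L. D w \<delta> L" if "w \<in> K" for w
    using fatou_local_Harnack[OF g, of w] that K(3) unfolding D_def \<Phi>_def
    by (metis subsetD)
  define P where "P w \<longleftrightarrow> (\<exists>L\<ge>0. \<forall>j\<ge>1. \<Phi> j w \<le> L * \<Phi> j z)" for w
  have step: "P y" if "D w \<delta> L" "x \<in> ball w \<delta>" "y \<in> ball w \<delta>" "P x" for w \<delta> L x y
  proof -
    obtain L' where L': "L' \<ge> 0" "\<And>j. j \<ge> 1 \<Longrightarrow> \<Phi> j x \<le> L' * \<Phi> j z"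
      using \<open>P x\<close> unfolding P_def by blast
    have "\<Phi> j y \<le> L * L' * \<Phi> j z" if "j \<ge> 1" for j
    proof -
      have "\<Phi> j y \<le> L * \<Phi> j x"
        using \<open>D w \<delta> L\<close> \<open>x \<in> ball w \<delta>\<close> \<open>y \<in> ball w \<delta>\<close> \<open>j \<ge> 1\<close> unfolding D_def by blast
      also have "\<dots> \<le> L * (L' * \<Phi> j z)"
        using L'(2)[OF \<open>j \<ge> 1\<close>] \<open>D w \<delta> L\<close> by (intro mult_left_mono) (auto simp: D_def)
      finally show ?thesis by (simp add: mult.assoc)
    qed
    moreover have "L * L' \<ge> 0"
      using L'(1) \<open>D w \<delta> L\<close> by (simp add: D_def)
    ultimately show ?thesis
      unfolding P_def by blast
  qed
  have "P z"
    unfolding P_def by (intro exI[of _ 1]) auto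
  have Pall: "P w" if "w \<in> K" for w
  proof (rule connected_induction_simple[where P = P, OF K(1) K(4) that \<open>P z\<close>])
    fix a assume "a \<in> K"
    then obtain \<delta> L where D: "D a \<delta> L"
      using loc by blast
    show "\<exists>T. openin (top_of_set K) T \<and> a \<in> T \<and> (\<forall>x\<in>T. \<forall>y\<in>T. P x \<longrightarrow> P y)"
    proof (intro exI[of _ "K \<inter> ball a \<delta>"] conjI ballI impI)
      show "a \<in> K \<inter> ball a \<delta>"
        using D \<open>a \<in> K\<close> by (simp add: D_def)
    qed (use step[OF D] in auto)
  qed
  \<comment> \<open>The pointwise property \<open>P w\<close> is widened to a ball around
    \<open>w\<close>, so that a finite subcover can be taken.\<close>
  have "\<exists>\<delta> L. \<delta> > 0 \<and> L \<ge> 0 \<and> (\<forall>j\<ge>1. \<forall>y\<in>ball w \<delta>. \<Phi> j y \<le> L * \<Phi> j z)" if "w \<in> K" for w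
  proof -
    obtain \<delta> L where D: "D w \<delta> L"
      using loc \<open>w \<in> K\<close> by blast
    obtain L' where L': "L' \<ge> 0" "\<And>j. j \<ge> 1 \<Longrightarrow> \<Phi> j w \<le> L' * \<Phi> j z"
      using Pall[OF \<open>w \<in> K\<close>] unfolding P_def by blast
    have "\<Phi> j y \<le> L * L' * \<Phi> j z" if "j \<ge> 1" "y \<in> ball w \<delta>" for j y
    proof -
      have "\<Phi> j y \<le> L * \<Phi> j w"
        using D that unfolding D_def by simp
      also have "\<dots> \<le> L * (L' * \<Phi> j z)"
        using L'(2)[OF \<open>j \<ge> 1\<close>] D by (intro mult_left_mono) (auto simp: D_def)
      finally show ?thesis by (simp add: mult.assoc)
    qed
    thus ?thesis
      using D L'(1) by (intro exI[of _ \<delta>] exI[of _ "L * L'"]) (auto simp: D_def)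
  qed
  then obtain \<delta> L where dL: "\<And>w. w \<in> K \<Longrightarrow> \<delta> w > 0" "\<And>w. w \<in> K \<Longrightarrow> L w \<ge> 0"
      "\<And>w j y. w \<in> K \<Longrightarrow> j \<ge> 1 \<Longrightarrow> y \<in> ball w (\<delta> w) \<Longrightarrow> \<Phi> j y \<le> L w * \<Phi> j z"
    by metis
  obtain T where T: "T \<subseteq> K" "finite T" "K \<subseteq> (\<Union>w\<in>T. ball w (\<delta> w))"
  proof (rule compactE_image[OF K(2), of K "\<lambda>w. ball w (\<delta> w)"])
    show "K \<subseteq> (\<Union>w\<in>K. ball w (\<delta> w))"
      using dL(1) by (auto intro!: bexI)
  qed auto
  show ?thesis
  \<comment> \<open>A finite sum of nonnegative constants dominates each of them.\<close>
  proof (rule that[of "sum L T"])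
    show "sum L T \<ge> 0"
      using T(1) dL(2) by (intro sum_nonneg) auto
    fix j w assume jw: "(j::nat) \<ge> 1" "w \<in> K"
    then obtain u where u: "u \<in> T" "w \<in> ball u (\<delta> u)"
      using T(3) by blast
    have "\<Phi> j w \<le> L u * \<Phi> j z"
      using dL(3) u T(1) jw by blast
    also have "L u \<le> sum L T"
      using T dL(2) u by (intro member_le_sum) auto
    hence "L u * \<Phi> j z \<le> sum L T * \<Phi> j z"
      using \<Phi>0 by (intro mult_right_mono) auto
    finally show "ln (exp 1 + norm ((g ^^ j) w)) \<le> sum L T * ln (exp 1 + norm ((g ^^ j) z))"
      unfolding \<Phi>_def .
  qed
qed

section \<open>Iterated exponentials\<close>

lemma exp_funpow_ge: "(x::real) \<le> (exp ^^ i) x"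
proof (induction i)
  case (Suc i)
  then show ?case
    using exp_ge_add_one_self[of "(exp ^^ i) x"] by (simp only: funpow.simps o_apply)
qed simp

lemma exp_funpow_mono: "(x::real) \<le> y \<Longrightarrow> (exp ^^ i) x \<le> (exp ^^ i) y"
  by (induction i) auto

lemma exp_funpow_less: "(x::real) < y \<Longrightarrow> (exp ^^ i) x < (exp ^^ i) y"
  by (induction i) auto

lemma ln_funpow_exp_funpow: "(ln ^^ i) ((exp ^^ i) (x::real)) = x"
proof (induction i)
  case (Suc i)
  have "(ln ^^ Suc i) ((exp ^^ Suc i) x) = (ln ^^ i) (ln (exp ((exp ^^ i) x)))"
    by (simp add: funpow_swap1)
  with Suc show ?case by simp
qed simp

text \<open>A factor moves inside one exponential at a time: \<open>A\<close> is at most exp(A - 1),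
  hence at most exp((A - 1) p) for p at least 1, and so A exp(p) is at most exp(A p).\<close>

lemma mult_exp_funpow_le:
  fixes A s :: real
  assumes "A \<ge> 1" "s \<ge> 1"
  shows "A * (exp ^^ i) s \<le> (exp ^^ i) (A * s)"
proof (induction i)
  case (Suc i)
  define p where "p = (exp ^^ i) s"
  have p: "p \<ge> 1"
    using exp_funpow_ge[of s i] assms by (simp add: p_def)
  have "A \<le> exp (A - 1)"
    using exp_ge_add_one_self[of "A - 1"] by simp
  also have "A - 1 \<le> (A - 1) * p"
    using mult_left_mono[of 1 p "A - 1"] p assms by simp
  hence "exp (A - 1) \<le> exp ((A - 1) * p)"
    by simp
  finally have "A * exp p \<le> exp ((A - 1) * p) * exp p"
    by (intro mult_right_mono) auto
  also have "\<dots> = exp (A * p)"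
    by (simp flip: exp_add add: algebra_simps)
  also have "\<dots> \<le> exp ((exp ^^ i) (A * s))"
    using Suc by (simp add: p_def)
  finally show ?case by (simp add: p_def)
qed simp

text \<open>The power multiplies the exponent of the outermost exponential by \<open>A\<close>; the
  factor then moves through the other \<open>n - 1\<close>.\<close>

lemma exp_funpow_powr_le:
  fixes A s :: real
  assumes "A \<ge> 1" "s \<ge> 1" "n \<ge> 1"
  shows "((exp ^^ n) s) powr A \<le> (exp ^^ n) (A * s)"
proof -
  obtain i where "n = Suc i"
    using assms(3) by (cases n) auto
  thus ?thesis
    using mult_exp_funpow_le[OF assms(1,2), of i] by (simp add: powr_def)
qed

section \<open>Growth along connected sets\<close>

text \<open>\<open>max_modulus\<close> is a supremum over the circle only; the maximum principle
  extends it to the disc.\<close>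

lemma norm_le_max_modulus:
  assumes "f holomorphic_on UNIV" "norm z \<le> r"
  shows "norm (f z) \<le> max_modulus r f"
proof -
  have r: "r \<ge> 0"
    using assms(2) norm_ge_zero order_trans by blast
  have cont: "continuous_on UNIV f"
    using assms(1) holomorphic_on_imp_continuous_on by blast
  show ?thesis
  proof (rule maximum_modulus_frontier[of f "cball 0 r"])
    show "f holomorphic_on interior (cball 0 r)" "continuous_on (closure (cball 0 r)) f"
      using assms(1) cont holomorphic_on_subset continuous_on_subset by blast+
    show "norm (f w) \<le> max_modulus r f" if "w \<in> frontier (cball 0 r)" for w
      using max_modulus_attained[OF cont r] that r by (auto simp: frontier_cball)
  qed (use assms in auto)
qed

text \<open>
  A single parameter \<open>N\<close> serves as a threshold, as a bound for the order and as the exponent of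
  the annular domain property, so that it can be chosen uniformly for finitely many functions.
\<close>

definition growth_bounds :: "nat \<Rightarrow> real \<Rightarrow> (complex \<Rightarrow> complex) \<Rightarrow> real \<Rightarrow> bool" where
  "growth_bounds n q f N \<longleftrightarrow>
     (\<forall>r\<ge>N. \<forall>z. norm z \<le> r \<longrightarrow> norm (f z) \<le> exp (r powr N)) \<and>
     (\<forall>r\<ge>N. \<forall>K. connected K \<longrightarrow> (\<exists>z\<in>K. norm z < r) \<longrightarrow> (\<exists>w\<in>K. norm w \<ge> r powr N) \<longrightarrow>
        (\<exists>w\<in>K. norm (f w) \<ge> (exp ^^ (n + 1)) (((ln ^^ n) r) powr q)))"

lemma finite_order_bound:
  assumes "entire_order f < \<infinity>"
    and large: "eventually (\<lambda>r. max_modulus r f > 0) at_top"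
  shows "\<exists>A. eventually (\<lambda>r. max_modulus r f \<le> exp (r powr A)) at_top"
proof -
  obtain A :: real where "entire_order f < ereal A"
    using ereal_dense2[OF assms(1)] by blast
  hence "eventually (\<lambda>r. ereal (ln (ln (max_modulus r f)) / ln r) < ereal A) at_top"
    unfolding entire_order_def by (rule Limsup_lessD)
  hence "eventually (\<lambda>r. max_modulus r f \<le> exp (r powr A)) at_top"
    using eventually_gt_at_top[of 1] large
  proof eventually_elim
    case (elim r)
    show ?case
    \<comment> \<open>Undoing the outer logarithm needs the inner one to be positive; otherwise the
      modulus is at most 1 and the bound is trivial.\<close>
    proof (cases "max_modulus r f > 1")
      case True
      have "ln (ln (max_modulus r f)) < A * ln r"
        using elim by (simp add: divide_simps)
      hence "exp (ln (ln (max_modulus r f))) \<le> exp (A * ln r)"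
        by simp
      hence "ln (max_modulus r f) \<le> r powr A"
        using True elim by (simp add: powr_def)
      hence "exp (ln (max_modulus r f)) \<le> exp (r powr A)"
        by simp
      thus ?thesis using True by simp
    next
      case False
      have "(1::real) \<le> exp (r powr A)" by simp
      thus ?thesis using False by linarith
    qed
  qed
  thus ?thesis ..
qed

text \<open>A connected set joining the ball of radius \<open>r\<close> to modulus
  \<open>r powr N\<close> both meets the annular domain and leaves it, so it meets the frontier,
  where \<open>f\<close> is at least its maximum modulus at \<open>r\<close>.\<close>

lemma growth_bounds_eventually:
  assumes hol: "f holomorphic_on UNIV" and ord: "entire_order f < \<infinity>"
    and ann: "annular_domain_property f m"
    and low: "eventually (\<lambda>r. max_modulus r f \<ge> (exp ^^ (n + 1)) (((ln ^^ n) r) powr q)) at_top"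
  shows "eventually (growth_bounds n q f) at_top"
proof -
  have "eventually (\<lambda>r. max_modulus r f > 0) at_top"
    using low
  proof eventually_elim
    case (elim r)
    have "0 < (exp ^^ (n + 1)) (((ln ^^ n) r) powr q)"
      by simp
    with elim show ?case
      by linarith
  qed
  then obtain A where "eventually (\<lambda>r. max_modulus r f \<le> exp (r powr A)) at_top"
    using finite_order_bound[OF ord] by blast
  then obtain R1 where R1: "\<And>r. r \<ge> R1 \<Longrightarrow> max_modulus r f \<le> exp (r powr A)"
    by (auto simp: eventually_at_top_linorder)
  obtain R2 where R2: "\<And>r. r \<ge> R2 \<Longrightarrow> max_modulus r f \<ge> (exp ^^ (n + 1)) (((ln ^^ n) r) powr q)"
    using low by (auto simp: eventually_at_top_linorder)
  obtain R3 where R3: "\<And>r. r \<ge> R3 \<Longrightarrow> \<exists>G. ball 0 r \<subseteq> G \<and> G \<subseteq> ball 0 (r powr m) \<and>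
        (\<forall>z\<in>frontier G. norm (f z) \<ge> max_modulus r f)"
    using ann unfolding annular_domain_property_def by metis
  show ?thesis
    unfolding eventually_at_top_linorder
  \<comment> \<open>The entry 1 ensures that \<open>r\<close> is at least 1, so raising the
    exponents \<open>A\<close> and \<open>m\<close> to \<open>N\<close> only enlarges the
    powers.\<close>
  proof (intro exI[of _ "Max {1, A, m, R1, R2, R3}"] allI impI)
    fix N assume "N \<ge> Max {1, A, m, R1, R2, R3}"
    hence N: "N \<ge> 1" "N \<ge> A" "N \<ge> m" "N \<ge> R1" "N \<ge> R2" "N \<ge> R3"
      by auto
    show "growth_bounds n q f N"
      unfolding growth_bounds_def
    proof (intro conjI allI impI)
      fix r z assume r: "N \<le> r" "norm (z::complex) \<le> r"
      have "norm (f z) \<le> max_modulus r f"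
        using hol r(2) by (rule norm_le_max_modulus)
      also have "\<dots> \<le> exp (r powr A)"
        using R1 r N by simp
      also have "\<dots> \<le> exp (r powr N)"
        using N r by (simp add: powr_mono)
      finally show "norm (f z) \<le> exp (r powr N)" .
    next
      fix r and K :: "complex set"
      assume r: "N \<le> r" and K: "connected K" "\<exists>z\<in>K. norm z < r" "\<exists>w\<in>K. norm w \<ge> r powr N"
      obtain G where G: "ball 0 r \<subseteq> G" "G \<subseteq> ball 0 (r powr m)"
          "\<forall>z\<in>frontier G. norm (f z) \<ge> max_modulus r f"
        using R3[of r] N r by auto
      have "r powr m \<le> r powr N"
        using N r by (intro powr_mono) auto
      hence "K - G \<noteq> {}" "K \<inter> G \<noteq> {}"
        using K(2,3) G(1,2) by fastforce+
      hence "K \<inter> frontier G \<noteq> {}"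
        by (intro connected_Int_frontier K(1))
      then obtain w where "w \<in> K" "norm (f w) \<ge> max_modulus r f"
        using G(3) by blast
      thus "\<exists>w\<in>K. norm (f w) \<ge> (exp ^^ (n + 1)) (((ln ^^ n) r) powr q)"
        using R2[of r] N r by force
    qed
  qed
qed

lemma growth_bounds_step:
  fixes s t N q :: real
  assumes gb: "growth_bounds n q f N" and N: "N \<ge> 1" and n: "n \<ge> 1"
    and s: "s \<ge> N" and t: "t / N > s"
    and K: "connected K" "z \<in> K" "norm z \<le> (exp ^^ n) s" "\<exists>w\<in>K. norm w \<ge> (exp ^^ n) t"
  shows "norm (f z) \<le> (exp ^^ n) (exp (N * s))"
    and "\<exists>w\<in>K. norm (f w) \<ge> (exp ^^ n) (exp ((t / N) powr q))"
proof -
  have "(exp ^^ n) s \<ge> N"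
    using exp_funpow_ge[of s n] s by linarith
  hence "norm (f z) \<le> exp (((exp ^^ n) s) powr N)"
    using gb K(3) unfolding growth_bounds_def by blast
  also have "\<dots> \<le> exp ((exp ^^ n) (N * s))"
    using exp_funpow_powr_le[of N s n] N s n by simp
  finally show "norm (f z) \<le> (exp ^^ n) (exp (N * s))"
    by (simp add: funpow_swap1)
next
  \<comment> \<open>Division by \<open>N\<close> keeps \<open>r powr N\<close> below the modulus
    that \<open>K\<close> reaches, while the gap between \<open>s\<close> and \<open>t / N\<close>
    leaves \<open>z\<close> inside radius \<open>r\<close>.\<close>
  define r where "r = (exp ^^ n) (t / N)"
  have "r \<ge> N"
    using exp_funpow_ge[of "t / N" n] s t by (simp add: r_def)
  moreover have "norm z < r"
    using K(3) exp_funpow_less[OF t, of n] by (simp add: r_def)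
  moreover have "r powr N \<le> (exp ^^ n) t"
    using exp_funpow_powr_le[OF N _ n, of "t / N"] N s t unfolding r_def by (smt (verit) nonzero_mult_div_cancel_left times_divide_eq_right)
  ultimately have "\<exists>w\<in>K. norm (f w) \<ge> (exp ^^ (n + 1)) (((ln ^^ n) r) powr q)"
    using gb K unfolding growth_bounds_def by (meson order_trans)
  thus "\<exists>w\<in>K. norm (f w) \<ge> (exp ^^ n) (exp ((t / N) powr q))"
    by (simp add: r_def ln_funpow_exp_funpow funpow_swap1)
qed

section \<open>The two recursions\<close>

text \<open>These recursions iterate the two conclusions of \<open>growth_bounds_step\<close>:
  \<open>slow_param\<close> bounds the image of the base point from above, \<open>fast_param\<close>
  the largest modulus on the connected set from below, both inside \<open>exp ^^ n\<close>.\<close>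

fun slow_param :: "real \<Rightarrow> real \<Rightarrow> nat \<Rightarrow> real" where
  "slow_param N s 0 = s"
| "slow_param N s (Suc i) = exp (N * slow_param N s i)"

fun fast_param :: "real \<Rightarrow> real \<Rightarrow> real \<Rightarrow> nat \<Rightarrow> real" where
  "fast_param N q t 0 = t"
| "fast_param N q t (Suc i) = exp ((fast_param N q t i / N) powr q)"

lemma slow_param_ge:
  assumes "N \<ge> 1" "s \<ge> 0"
  shows "slow_param N s i \<ge> s"
proof (induction i)
  case (Suc i)
  have "slow_param N s i \<le> N * slow_param N s i"
    using Suc assms mult_right_mono[of 1 N "slow_param N s i"] by simp
  also have "\<dots> \<le> exp (N * slow_param N s i)"
    using exp_ge_add_one_self[of "N * slow_param N s i"] by linarith
  finally show ?case using Suc by simp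
qed simp

text \<open>
  After rescaling, the recursions become \<open>X' = N e^X\<close> and \<open>v' = c e^v\<close> with
  \<open>X = N s\<close>, \<open>v = q (t/N)^q\<close> and \<open>c = q N^(-q)\<close>; once the difference \<open>v - X\<close> exceeds a suitable
  constant it increases by at least 1 in every step.
\<close>

lemma fast_over_slow:
  fixes N q s :: real
  assumes N: "N \<ge> 1" and q: "0 < q" "q < 1" and s: "s \<ge> N"
  obtains t where "\<And>i. fast_param N q t i / N > slow_param N s i"
    "\<And>L. \<exists>i0. \<forall>i\<ge>i0. fast_param N q t i \<ge> L * slow_param N s i"
proof -
  define c where "c = q * N powr (-q)"
  have c: "c > 0"
    using q N by (simp add: c_def)
  \<comment> \<open>For \<open>d\<close> at least \<open>C\<close>, c d^2 / 2 is at least (N + 2) d,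
    which absorbs \<open>N + d + 1\<close>.\<close>
  define C where "C = Max {1, 2 * (N + 2) / c}"
  have C: "C \<ge> 1" "C \<ge> 2 * (N + 2) / c"
    by (auto simp: C_def)
  have key: "c * exp d - N \<ge> d + 1" if "d \<ge> C" for d
  proof -
    have d: "d \<ge> 1" "d * c \<ge> 2 * (N + 2)"
      using that C c by (auto simp: divide_simps intro: order_trans)
    have "exp d \<ge> 1 + d + d\<^sup>2 / 2"
      using d by (intro exp_lower_Taylor_quadratic) auto
    hence "exp d \<ge> d * d / 2"
      using d by (simp add: power2_eq_square)
    hence "c * exp d \<ge> c * (d * d / 2)"
      using c by (intro mult_left_mono) auto
    also have "c * (d * d / 2) = (d * c) * d / 2"
      by simp
    also have "(d * c) * d / 2 \<ge> (2 * (N + 2)) * d / 2"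
      using d by (intro divide_right_mono mult_right_mono) auto
    also have "(2 * (N + 2)) * d / 2 = N * d + 2 * d"
      by (simp add: algebra_simps)
    finally show ?thesis
      using mult_left_mono[of 1 d N] N d by linarith
  qed
  \<comment> \<open>Solves \<open>v 0 = X 0 + C\<close>, so the difference starts at the
    threshold.\<close>
  define t where "t = N * (((N * s + C) / q) powr (1 / q))"
  define X where "X i = N * slow_param N s i" for i
  define v where "v i = q * (fast_param N q t i / N) powr q" for i
  have X0: "X i \<ge> 0" for i
    using slow_param_ge[of N s i] N s by (simp add: X_def)
  have XS: "X (Suc i) = N * exp (X i)" for i
    by (simp add: X_def)
  have vS: "v (Suc i) = c * exp (v i)" for i
    using N by (simp add: v_def c_def powr_divide powr_minus powr_def[of "exp _"] field_simps)
  have "v 0 = N * s + C"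
    using N q C s by (simp add: v_def t_def powr_powr)
  have diff: "v i - X i \<ge> C + real i" for i
  proof (induction i)
    case 0
    then show ?case using \<open>v 0 = N * s + C\<close> by (simp add: X_def)
  next
    case (Suc i)
    have "v (Suc i) - X (Suc i) = exp (X i) * (c * exp (v i - X i) - N)"
      by (simp add: vS XS exp_diff field_simps)
    moreover have "1 * (c * exp (v i - X i) - N) \<le> exp (X i) * (c * exp (v i - X i) - N)"
      using key[of "v i - X i"] Suc C X0[of i] by (intro mult_right_mono) auto
    moreover have "c * exp (v i - X i) - N \<ge> v i - X i + 1"
      using Suc C by (intro key) auto
    ultimately show ?case using Suc by simp
  qed
  \<comment> \<open>Returns to the original scale: \<open>v\<close> is at least 1, which forces
    \<open>x\<close> to be at least 1, and then the exponent \<open>q\<close> below 1 and the factor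
    \<open>q\<close> only decrease it.\<close>
  have tv: "fast_param N q t i / N \<ge> v i" for i
  proof -
    define x where "x = fast_param N q t i / N"
    have "q * x powr q \<ge> 1"
      using diff[of i] C X0[of i] unfolding v_def x_def by linarith
    hence xq: "x powr q \<ge> 1 / q"
      using q by (simp add: field_simps)
    have "1 / q > 1"
      using q by simp
    have "x \<ge> 1"
    proof (rule ccontr)
      assume "\<not> x \<ge> 1"
      moreover have "x \<ge> 0"
      proof (cases i)
        case 0
        then show ?thesis using N by (simp add: x_def t_def)
      next
        case (Suc i)
        then show ?thesis using N by (simp add: x_def)
      qed
      ultimately have "x powr q \<le> 1"
        using q by (simp add: powr_le1)
      with xq \<open>1 / q > 1\<close> show False by linarith
    qed
    hence "x powr q \<le> x powr 1"
      using q by (intro powr_mono) auto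
    hence "x powr q \<le> x" using \<open>x \<ge> 1\<close> by simp
    moreover have "q * x powr q \<le> 1 * x powr q"
      using q by (intro mult_right_mono) auto
    ultimately show ?thesis
      unfolding v_def x_def by linarith
  qed
  have sX: "slow_param N s i \<le> X i" for i
    using slow_param_ge[of N s i] N s mult_right_mono[of 1 N "slow_param N s i"]
    by (simp add: X_def)
  show ?thesis
  proof (rule that[of t])
    show "fast_param N q t i / N > slow_param N s i" for i
      using tv[of i] sX[of i] diff[of i] C by linarith
    fix L :: real
    define L' where "L' = max L 0"
    obtain j0 :: nat where j0: "real j0 \<ge> L' * N / c"
      using real_arch_simple by blast
    show "\<exists>i0. \<forall>i\<ge>i0. fast_param N q t i \<ge> L * slow_param N s i"
    \<comment> \<open>The ratio of \<open>v\<close> to \<open>X\<close> at index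
      \<open>Suc j\<close> is (c / N) exp(v j - X j), governed by the difference one step earlier;
      hence the successor.\<close>
    proof (intro exI[of _ "Suc j0"] allI impI)
      fix i assume "Suc j0 \<le> i"
      then obtain j where j: "i = Suc j" "j \<ge> j0"
        by (cases i) auto
      have sp: "slow_param N s i \<ge> 0"
        using slow_param_ge[of N s i] N s by simp
      have "L * slow_param N s i \<le> L' * slow_param N s i"
        using sp by (intro mult_right_mono) (auto simp: L'_def)
      also have "\<dots> \<le> L' * X i"
        using sX by (intro mult_left_mono) (auto simp: L'_def)
      also have "\<dots> = (L' * N) * exp (X j)"
        by (simp add: j XS)
      also have "L' * N \<le> c * exp (v j - X j)"
      proof -
        have "L' * N \<le> c * real j0"
          using j0 c by (simp add: field_simps)
        also have "real j0 \<le> v j - X j"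
          using diff[of j] C j by simp
        hence "real j0 \<le> exp (v j - X j)"
          using exp_ge_add_one_self[of "v j - X j"] by linarith
        hence "c * real j0 \<le> c * exp (v j - X j)"
          using c by (intro mult_left_mono) auto
        finally show ?thesis .
      qed
      hence "(L' * N) * exp (X j) \<le> c * exp (v j - X j) * exp (X j)"
        by (intro mult_right_mono) auto
      also have "\<dots> = v i"
        by (simp add: j vS exp_diff)
      also have "\<dots> \<le> fast_param N q t i / N"
        by (rule tv)
      also have "\<dots> \<le> fast_param N q t i"
        using N j by (simp add: divide_simps)
      finally show "L * slow_param N s i \<le> fast_param N q t i" .
    qed
  qed
qed

section \<open>Compositions\<close>

definition stretches :: "nat \<Rightarrow> complex set \<Rightarrow> complex \<Rightarrow> real \<Rightarrow> real \<Rightarrow> (complex \<Rightarrow> complex) \<Rightarrow> bool" where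
  "stretches n K z s t h \<longleftrightarrow>
     norm (h z) \<le> (exp ^^ n) s \<and> (\<exists>w\<in>K. norm (h w) \<ge> (exp ^^ n) t)"

text \<open>Each list element, from the last to the first, contributes one growth step. The
  arbitrary \<open>h\<close> and offset \<open>i\<close> let the composition continue from an
  earlier iterate.\<close>

lemma stretches_foldr:
  fixes s t N q :: real
  assumes K: "connected K" "z \<in> K" and N: "N \<ge> 1" and n: "n \<ge> 1" and s: "s \<ge> N"
    and gap: "\<And>i. fast_param N q t i / N > slow_param N s i"
    and fs: "\<And>f. f \<in> set fs \<Longrightarrow> f holomorphic_on UNIV \<and> growth_bounds n q f N"
    and h: "h holomorphic_on UNIV" "stretches n K z (slow_param N s i) (fast_param N q t i) h"
  shows "(foldr (\<circ>) fs id \<circ> h) holomorphic_on UNIV \<and>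
    stretches n K z (slow_param N s (i + length fs)) (fast_param N q t (i + length fs))
      (foldr (\<circ>) fs id \<circ> h)"
  using fs
proof (induction fs)
  case Nil
  then show ?case using h by simp
next
  case (Cons f fs)
  define p where "p = foldr (\<circ>) fs id \<circ> h"
  define i' where "i' = i + length fs"
  have p: "p holomorphic_on UNIV" "stretches n K z (slow_param N s i') (fast_param N q t i') p"
    using Cons.IH Cons.prems unfolding p_def i'_def by (metis list.set_intros(2))+
  have f: "f holomorphic_on UNIV" "growth_bounds n q f N"
    using Cons.prems by auto
  \<comment> \<open>The growth step for \<open>f\<close> is applied to this image and to the point
    \<open>p z\<close>.\<close>
  have "connected (p ` K)"
    using p(1) K(1) by (meson connected_continuous_image continuous_on_subset
        holomorphic_on_imp_continuous_on subset_UNIV)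
  moreover have "slow_param N s i' \<ge> N"
    using slow_param_ge[of N s i'] N s by simp
  ultimately have "norm (f (p z)) \<le> (exp ^^ n) (exp (N * slow_param N s i'))"
    "\<exists>w\<in>p ` K. norm (f w) \<ge> (exp ^^ n) (exp ((fast_param N q t i' / N) powr q))"
    using growth_bounds_step[OF f(2) N n _ gap, of i' "p ` K" "p z"] p(2) K(2)
    unfolding stretches_def by auto
  hence "stretches n K z (slow_param N s (Suc i')) (fast_param N q t (Suc i')) (f \<circ> p)"
    unfolding stretches_def by auto
  moreover have "foldr (\<circ>) (f # fs) id \<circ> h = f \<circ> p"
    by (simp add: p_def fun_eq_iff)
  moreover have "i + length (f # fs) = Suc i'"
    by (simp add: i'_def)
  ultimately show ?case
    using holomorphic_on_UNIV_compose[OF f(1) p(1)] by (simp only:)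
qed

lemma stretches_funpow:
  fixes s t N q :: real
  assumes K: "connected K" "z \<in> K" and N: "N \<ge> 1" and n: "n \<ge> 1" and s: "s \<ge> N"
    and gap: "\<And>i. fast_param N q t i / N > slow_param N s i"
    and fs: "\<And>f. f \<in> set fs \<Longrightarrow> f holomorphic_on UNIV \<and> growth_bounds n q f N"
    and init: "stretches n K z s t id"
  shows "((foldr (\<circ>) fs id) ^^ j) holomorphic_on UNIV \<and>
    stretches n K z (slow_param N s (j * length fs)) (fast_param N q t (j * length fs))
      ((foldr (\<circ>) fs id) ^^ j)"
proof (induction j)
  case 0
  then show ?case using init by (simp add: id_def)
next
  case (Suc j)
  show ?case
    using stretches_foldr[OF K N n s gap fs conjunct1[OF Suc] conjunct2[OF Suc]]
    by (simp only: funpow.simps mult_Suc add.commute)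
qed

section \<open>The contradiction on an unbounded component\<close>

lemma unbounded_norm_ge:
  assumes "\<not> bounded S"
  shows "\<exists>x\<in>S. norm x \<ge> B"
  using assms unfolding bounded_iff by (meson linear)

theorem corollary7p1:
  fixes k n :: nat and q :: real
    and f :: "nat \<Rightarrow> complex \<Rightarrow> complex"
    and g :: "complex \<Rightarrow> complex"
  assumes "k \<ge> 1"
    and "\<And>j. j \<in> {1..k} \<Longrightarrow> transcendental_entire (f j)"
    and "\<And>j. j \<in> {1..k} \<Longrightarrow> entire_order (f j) < \<infinity>"
    and "\<And>j. j \<in> {1..k} \<Longrightarrow> \<exists>m>1. annular_domain_property (f j) m"
    and "n \<ge> 1" and "0 < q" and "q < 1"
    and "\<And>j. j \<in> {1..k} \<Longrightarrow>
           eventually (\<lambda>r. max_modulus r (f j) \<ge> (exp ^^ (n + 1)) (((ln ^^ n) r) powr q)) at_top"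
    and "g = foldr (\<circ>) (map f [1..<Suc k]) id"
  shows "\<forall>C \<in> components (fatou_set g). bounded C"
proof (rule ballI, rule ccontr)
  fix C assume C: "C \<in> components (fatou_set g)" and unb: "\<not> bounded C"
  have hol: "f j holomorphic_on UNIV" if "j \<in> {1..k}" for j
    using assms(2)[OF that] by (simp add: transcendental_entire_def)
  have "eventually (growth_bounds n q (f j)) at_top" if "j \<in> {1..k}" for j
    using growth_bounds_eventually[OF hol[OF that] assms(3)[OF that] _ assms(8)[OF that]]
      assms(4)[OF that] by blast
  hence "eventually (\<lambda>N. \<forall>j\<in>{1..k}. growth_bounds n q (f j) N) at_top"
    by (intro eventually_ball_finite) auto
  \<comment> \<open>The bound 3 passes through \<open>s\<close> and \<open>slow_param\<close> to
    \<open>exp a\<close>, where \<open>ln_exp_add_le\<close> needs it.\<close>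
  hence "eventually (\<lambda>N. (\<forall>j\<in>{1..k}. growth_bounds n q (f j) N) \<and> N \<ge> 3) at_top"
    using eventually_ge_at_top by (rule eventually_conj)
  from eventually_happens[OF this]
  obtain N where "(\<forall>j\<in>{1..k}. growth_bounds n q (f j) N) \<and> N \<ge> 3"
    using trivial_limit_at_top_linorder by blast
  hence gb: "\<And>j. j \<in> {1..k} \<Longrightarrow> growth_bounds n q (f j) N" and N: "N \<ge> 3"
    by auto
  have N1: "N \<ge> 1"
    using N by simp
  define fs where "fs = map f [1..<Suc k]"
  have fs: "h holomorphic_on UNIV \<and> growth_bounds n q h N" if "h \<in> set fs" for h
    using that hol gb by (auto simp: fs_def simp del: upt_Suc)
  have len: "length fs = k"
    by (simp add: fs_def)
  obtain z where z: "z \<in> C"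
    using unb by (metis bounded_empty equals0I)
  define s where "s = max N (norm z)"
  have s: "s \<ge> N" "norm z \<le> (exp ^^ n) s"
    using exp_funpow_ge[of s n] by (auto simp: s_def)
  obtain t where gap: "\<And>i. fast_param N q t i / N > slow_param N s i"
    and ratio: "\<And>L. \<exists>i0. \<forall>i\<ge>i0. fast_param N q t i \<ge> L * slow_param N s i"
    using fast_over_slow[OF N1 assms(6,7) s(1)] by blast
  \<comment> \<open>\<open>t\<close> depends on \<open>s\<close> but not on the path, so
    \<open>w\<close> can be chosen after it. The Harnack constant depends on the path, which is
    harmless because \<open>ratio\<close> holds for every \<open>L\<close>.\<close>
  obtain w where w: "w \<in> C" "norm w \<ge> (exp ^^ n) t"
    using unbounded_norm_ge[OF unb] by blast
  have "open C" "connected C"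
    using open_components[OF open_fatou_set C] in_components_connected[OF C] by auto
  hence "path_connected C"
    using connected_open_path_connected by blast
  then obtain \<gamma> where \<gamma>: "path \<gamma>" "path_image \<gamma> \<subseteq> C" "pathstart \<gamma> = z" "pathfinish \<gamma> = w"
    using z w(1) unfolding path_connected_def by blast
  define K where "K = path_image \<gamma>"
  have K: "connected K" "compact K" "K \<subseteq> fatou_set g" "z \<in> K" "w \<in> K"
    using \<gamma> in_components_subset[OF C]
    by (auto simp: K_def connected_path_image compact_path_image pathstart_in_path_image
        pathfinish_in_path_image)
  have init: "stretches n K z s t id"
    using s w K by (auto simp: stretches_def)
  have gj: "(g ^^ j) holomorphic_on UNIV \<and>
      stretches n K z (slow_param N s (j * k)) (fast_param N q t (j * k)) (g ^^ j)" for j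
    using stretches_funpow[OF K(1,4) N1 assms(5) s(1) gap fs init, where fs = fs]
    unfolding len by (simp add: assms(9) fs_def)
  have "g holomorphic_on UNIV"
    using gj[of 1] by simp
  from fatou_compact_Harnack[OF this K(1-4)] obtain L where L: "L \<ge> 0"
    "\<And>j w. j \<ge> 1 \<Longrightarrow> w \<in> K \<Longrightarrow>
       ln (exp 1 + norm ((g ^^ j) w)) \<le> L * ln (exp 1 + norm ((g ^^ j) z))"
    by metis
  \<comment> \<open>The factor 2 comes from \<open>ln_exp_add_le\<close>; the added 1 makes the
    final inequality strict and gives the lower bound 1 that \<open>mult_exp_funpow_le\<close>
    requires.\<close>
  define L' where "L' = 2 * L + 1"
  obtain i0 where i0: "\<And>i. i \<ge> i0 \<Longrightarrow> fast_param N q t i \<ge> L' * slow_param N s i"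
    using ratio by blast
  \<comment> \<open>The successor ensures that \<open>j\<close> is at least 1, as the Harnack bound
    demands.\<close>
  define j where "j = Suc i0"
  define \<sigma> where "\<sigma> = slow_param N s (j * k)"
  define \<tau> where "\<tau> = fast_param N q t (j * k)"
  have "j * k \<ge> i0"
    using assms(1) mult_le_mono2[of 1 k j] by (simp add: j_def)
  hence \<tau>\<sigma>: "\<tau> \<ge> L' * \<sigma>"
    using i0 by (simp add: \<sigma>_def \<tau>_def)
  have \<sigma>: "\<sigma> \<ge> 3"
    using slow_param_ge[of N s "j * k"] N s by (simp add: \<sigma>_def)
  \<comment> \<open>The logarithm in the Harnack bound removes one of the \<open>n\<close>
    exponentials; the comparison takes place under the remaining \<open>i\<close>.\<close>
  obtain i where ni: "n = Suc i"
    using assms(5) by (cases n) auto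
  define a where "a = (exp ^^ i) \<sigma>"
  have a: "a \<ge> 3"
    using exp_funpow_ge[of \<sigma> i] \<sigma> by (simp add: a_def)
  have ea: "exp a \<ge> 3"
    using a exp_ge_add_one_self[of a] by linarith
  have "L' * a \<le> (exp ^^ i) (L' * \<sigma>)"
    unfolding a_def using L(1) \<sigma> by (intro mult_exp_funpow_le) (auto simp: L'_def)
  also have "\<dots> \<le> (exp ^^ i) \<tau>"
    using \<tau>\<sigma> by (rule exp_funpow_mono)
  finally have *: "L' * a \<le> (exp ^^ i) \<tau>" .
  have "stretches n K z \<sigma> \<tau> (g ^^ j)"
    using gj by (simp add: \<sigma>_def \<tau>_def)
  then obtain u where u: "norm ((g ^^ j) z) \<le> exp a" "u \<in> K" "norm ((g ^^ j) u) \<ge> exp ((exp ^^ i) \<tau>)"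
    unfolding stretches_def by (auto simp: ni a_def)
  have "exp ((exp ^^ i) \<tau>) \<le> exp 1 + norm ((g ^^ j) u)"
    using u(3) exp_gt_zero[of "1::real"] by linarith
  hence **: "ln (exp ((exp ^^ i) \<tau>)) \<le> ln (exp 1 + norm ((g ^^ j) u))"
    by (intro ln_mono) auto
  have "(exp ^^ i) \<tau> = ln (exp ((exp ^^ i) \<tau>))"
    by simp
  also have "\<dots> \<le> ln (exp 1 + norm ((g ^^ j) u))"
    by (rule **)
  also have "\<dots> \<le> L * ln (exp 1 + norm ((g ^^ j) z))"
    using L(2)[of j u] u(2) by (simp add: j_def)
  also have "\<dots> \<le> L * ln (exp 1 + exp a)"
    using u(1) L(1) by (intro mult_left_mono ln_mono) (auto intro: add_pos_nonneg)
  also have "\<dots> \<le> L * (2 * ln (exp a))"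
    using ea L(1) by (intro mult_left_mono ln_exp_add_le)
  also have "\<dots> = 2 * L * a"
    by simp
  also have "\<dots> < L' * a"
    using a by (simp add: L'_def algebra_simps)
  finally show False
    using * by simp
qed

end
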